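(* Let $U_1,\ldots,U_n$ be closed linear subspaces of a real Hilbert space $\mathcal H$, $A_i=N_{U_i}$ for $i=1,\ldots,n$, and $U=U_1\cap\cdots\cap U_n$. Let $G=(\mathcal N,\mathcal E)$ be an algorithmic graph of order $n\ge2$, $G'=(\mathcal N,\mathcal E')$ a connected spanning subgraph of $G$, and $Z\in\mathbb R^{n\times(n-1)}$ with $\operatorname{Lap}(G')=ZZ^*$. Let $\widetilde{\mathcal T}=\mathcal C^*(\mathcal M+\mathcal A)^{-1}\mathcal C:\mathcal H^{n-1}\to\mathcal H^{n-1}$, $\boldsymbol\alpha=Z^\dagger\boldsymbol\delta\in\mathbb R^{n-1}$ and $E=Z_\otimes^\dagger(\mathcal U^\perp\cap\Delta_n^\perp)\subseteq\mathcal H^{n-1}$, as defined in the context. Then $$P_{\operatorname{Fix}\widetilde{\mathcal T}}=\boldsymbol\alpha_\otimes P_U\boldsymbol\alpha_\otimes^\dagger+P_E.$$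
   Context: $\mathcal H^m$ carries the inner product $\langle\boldsymbol x,\boldsymbol y\rangle=\sum_i\langle x_i,y_i\rangle$. $N_{U_i}(x)=U_i^\perp$ if $x\in U_i$ and $\emptyset$ otherwise (normal cone). $P_S$ is the orthogonal projection onto $S$. $\operatorname{Fix}T=\{x\mid T(x)=x\}$. Graphs: an algorithmic graph of order $n\ge2$ is a directed graph $G=(\mathcal N,\mathcal E)$ with $\mathcal N=\{1,\ldots,n\}$, $\mathcal E\subseteq\mathcal N\times\mathcal N$, $(i,j)\in\mathcal E\Rightarrow i<j$, and $G$ connected (ignoring edge directions). $G'$ is a spanning subgraph of $G$ if $\mathcal E'\subseteq\mathcal E$. $d_i^{\rm in}=|\{j:(j,i)\in\mathcal E\}|$, $d_i^{\rm out}=|\{j:(i,j)\in\mathcal E\}|$, $d_i=d_i^{\rm in}+d_i^{\rm out}$ are the degrees in $G$. The Laplacian of a graph is the $n\times n$ matrix with the degrees of that graph on the diagonal, $-1$ in entry $(i,j)$ if $i,j$ are adjacent (i.e. $(i,j)$ or $(j,i)$ is an edge), and $0$ otherwise. The degree balance of $G$ is $\boldsymbol\delta\in\mathbb R^n$, $\delta_i=d_i^{\rm out}-d_i^{\rm in}$. Notation: for $K\in\mathbb R^{m\times p}$, $K_\otimes:\mathcal H^p\to\mathcal H^m$, $(K_\otimes\boldsymbol x)_i=\sum_jK_{i,j}x_j$; for $\boldsymbol\beta\in\mathbb R^m$, $\boldsymbol\beta_\otimes x=(\beta_1x,\ldots,\beta_mx)$. $Z^\dagger$, $\boldsymbol\alpha^\dagger$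 are Moore--Penrose inverses ($\boldsymbol\alpha\ne0$ and $\boldsymbol\alpha^\dagger=\boldsymbol\alpha^*/\|\boldsymbol\alpha\|^2$), $Z_\otimes^\dagger=(Z^\dagger)_\otimes$, and $\boldsymbol\alpha_\otimes^\dagger\boldsymbol v=\|\boldsymbol\alpha\|^{-2}\sum_j\alpha_jv_j$. $\Delta_n=\{(x,\ldots,x)\in\mathcal H^n\mid x\in\mathcal H\}$, $\mathcal U=U_1\times\cdots\times U_n\subseteq\mathcal H^n$. Operators: $\mathcal A_D(\boldsymbol x)=A_1(x_1)\times\cdots\times A_n(x_n)$ for $\boldsymbol x\in\mathcal H^n$. $P(G)\in\mathbb R^{n\times n}$ has entries $P(G)_{i,i}=d_i$, $P(G)_{i,j}=-2$ if $(j,i)\in\mathcal E$, and $0$ otherwise. On $\mathcal H^{2n-1}=\mathcal H^n\times\mathcal H^{n-1}$, $$\mathcal M=\begin{bmatrix}\operatorname{Lap}(G') & Z \\ Z^* & I_{n-1}\end{bmatrix}_\otimes,\quad \mathcal C=\begin{bmatrix} Z \\ I_{n-1}\end{bmatrix}_\otimes:\mathcal H^{n-1}\to\mathcal H^{2n-1},\quad \mathcal A=\begin{bmatrix}\mathcal A_D+P(G)_\otimes-\operatorname{Lap}(G')_\otimes & -Z_\otimes \\ Z^*_\otimes & 0\end{bmatrix}.$$ $(\mathcal M+\mathcal A)^{-1}$ is the inverse as a set-valued operator (it is single-valued with full domain). *)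

theory Defs
  imports "HOL-Analysis.Analysis" "Graph_Theory.Graph_Theory"
begin

text \<open>
  A real Hilbert space is a type of sort \<open>{real_inner, banach}\<close>; the Hilbert direct sum
  $H^n$ is \<open>'a ^ 'n\<close>, whose library inner product is the sum of the componentwise ones.
  The nodes $1 < \dots < n$ are the elements of a finite linearly ordered type \<open>'n\<close>, so
  $n$ is \<open>CARD('n)\<close>. An index type \<open>'m\<close> with \<open>CARD('m) + 1 = CARD('n)\<close> plays the role of
  $\{1, \dots, n-1\}$, and $H^{2n-1} = H^n \times H^{n-1}$ is the type \<open>('a ^ 'n) \<times> ('a ^ 'm)\<close>.
\<close>


section \<open>Algorithmic graphs\<close>

text \<open>The library's digraph connectedness ignores edge directions. Its name is also that of
  topological connectedness, hence the qualification.\<close>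

abbreviation graph_connected :: "'n pair_pre_digraph \<Rightarrow> bool" where
  "graph_connected G \<equiv> Digraph_Component.connected (with_proj G)"

definition algorithmic_graph :: "'n::{finite,linorder} pair_pre_digraph \<Rightarrow> bool" where
  "algorithmic_graph G \<longleftrightarrow>
     CARD('n) \<ge> 2 \<and> pverts G = UNIV \<and> (\<forall>(i, j) \<in> parcs G. i < j) \<and> graph_connected G"

definition graph_degree :: "'n pair_pre_digraph \<Rightarrow> 'n \<Rightarrow> nat" where
  "graph_degree G i = in_degree (with_proj G) i + out_degree (with_proj G) i"

definition laplacian :: "'n::finite pair_pre_digraph \<Rightarrow> real ^ 'n ^ 'n" where
  "laplacian G = (\<chi> i j. if i = j then real (graph_degree G i)
                        else if (i, j) \<in> parcs G \<or> (j, i) \<in> parcs G then -1 else 0)"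

definition degree_balance :: "'n::finite pair_pre_digraph \<Rightarrow> real ^ 'n" where
  "degree_balance G =
     (\<chi> i. real (out_degree (with_proj G) i) - real (in_degree (with_proj G) i))"

definition P_matrix :: "'n::finite pair_pre_digraph \<Rightarrow> real ^ 'n ^ 'n" where
  "P_matrix G = (\<chi> i j. if i = j then real (graph_degree G i)
                       else if (j, i) \<in> parcs G then -2 else 0)"


section \<open>Matrices acting on powers of a Hilbert space\<close>

definition tensor :: "real ^ 'p ^ 'm \<Rightarrow> 'a::real_vector ^ 'p \<Rightarrow> 'a ^ 'm" where
  "tensor K x = (\<chi> i. \<Sum>j\<in>UNIV. K $ i $ j *\<^sub>R x $ j)"

definition tensor_vec :: "real ^ 'm \<Rightarrow> 'a::real_vector \<Rightarrow> 'a ^ 'm" where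
  "tensor_vec \<beta> x = (\<chi> i. \<beta> $ i *\<^sub>R x)"

text \<open>The operator induced by the Moore-Penrose inverse of the column vector \<open>\<beta>\<close>; meaningful
  for \<open>\<beta> \<noteq> 0\<close>.\<close>

definition tensor_vec_pinv :: "real ^ 'm \<Rightarrow> 'a::real_vector ^ 'm \<Rightarrow> 'a" where
  "tensor_vec_pinv \<beta> v = (1 / (norm \<beta>)\<^sup>2) *\<^sub>R (\<Sum>j\<in>UNIV. \<beta> $ j *\<^sub>R v $ j)"

text \<open>The operator induced by the block matrix with rows \<open>K L\<close> and \<open>M N\<close>.\<close>

definition block_tensor ::
    "real ^ 'n ^ 'n \<Rightarrow> real ^ 'm ^ 'n \<Rightarrow> real ^ 'n ^ 'm \<Rightarrow> real ^ 'm ^ 'm \<Rightarrow>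
     ('a::real_vector ^ 'n) \<times> ('a ^ 'm) \<Rightarrow> ('a ^ 'n) \<times> ('a ^ 'm)" where
  "block_tensor K L M N =
     (\<lambda>(x, v). (tensor K x + tensor L v, tensor M x + tensor N v))"

text \<open>The Moore-Penrose inverse, as the unique solution of the four Penrose equations.\<close>

definition moore_penrose :: "real ^ 'm ^ 'n \<Rightarrow> real ^ 'n ^ 'm" where
  "moore_penrose K = (THE X. K ** X ** K = K \<and> X ** K ** X = X \<and>
     transpose (K ** X) = K ** X \<and> transpose (X ** K) = X ** K)"


section \<open>Projections and set-valued operators\<close>

text \<open>The library's \<open>closest_point\<close> requires a Heine-Borel, hence finite-dimensional, space.
  The following is meaningful for closed linear subspaces \<open>S\<close> of a Hilbert space.\<close>

definition orth_proj :: "'a::real_inner set \<Rightarrow> 'a \<Rightarrow> 'a" where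
  "orth_proj S x = (THE p. p \<in> S \<and> x - p \<in> S\<^sup>\<bottom>)"

definition Fix :: "('a \<Rightarrow> 'a) \<Rightarrow> 'a set" where
  "Fix T = {x. T x = x}"

text \<open>The normal cone operator of a linear subspace.\<close>

definition normal_cone :: "'a::real_inner set \<Rightarrow> 'a \<Rightarrow> 'a set" where
  "normal_cone S x = (if x \<in> S then S\<^sup>\<bottom> else {})"

definition inverse_op :: "('a \<Rightarrow> 'b set) \<Rightarrow> 'b \<Rightarrow> 'a set" where
  "inverse_op F y = {x. y \<in> F x}"

text \<open>The sum of a single-valued and a set-valued operator.\<close>

definition add_op :: "('a \<Rightarrow> 'b::plus) \<Rightarrow> ('a \<Rightarrow> 'b set) \<Rightarrow> 'a \<Rightarrow> 'b set" where
  "add_op f F x = {f x + y | y. y \<in> F x}"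

definition product_op :: "('n \<Rightarrow> 'a \<Rightarrow> 'a set) \<Rightarrow> 'a ^ 'n \<Rightarrow> ('a ^ 'n) set" where
  "product_op A x = {y. \<forall>i. y $ i \<in> A i (x $ i)}"

definition product_space :: "('n \<Rightarrow> 'a set) \<Rightarrow> ('a ^ 'n) set" where
  "product_space U = {x. \<forall>i. x $ i \<in> U i}"

definition diagonal_space :: "('a ^ 'n) set" where
  "diagonal_space = range (\<lambda>x. \<chi> i. x)"


section \<open>The reduced operator\<close>

definition M_op ::
    "'n::finite pair_pre_digraph \<Rightarrow> real ^ 'm ^ 'n \<Rightarrow>
     ('a::real_vector ^ 'n) \<times> ('a ^ 'm) \<Rightarrow> ('a ^ 'n) \<times> ('a ^ 'm)" where
  "M_op G' Z = block_tensor (laplacian G') Z (transpose Z) (mat 1)"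

definition C_op :: "real ^ 'm ^ 'n \<Rightarrow> 'a::real_vector ^ 'm \<Rightarrow> ('a ^ 'n) \<times> ('a ^ 'm)" where
  "C_op Z v = (tensor Z v, tensor (mat 1) v)"

definition A_op ::
    "('n::finite \<Rightarrow> 'a \<Rightarrow> 'a set) \<Rightarrow> 'n pair_pre_digraph \<Rightarrow> 'n pair_pre_digraph \<Rightarrow>
     real ^ 'm ^ 'n \<Rightarrow> ('a::real_vector ^ 'n) \<times> ('a ^ 'm) \<Rightarrow> (('a ^ 'n) \<times> ('a ^ 'm)) set" where
  "A_op A G G' Z = (\<lambda>(x, v).
     {(a + tensor (P_matrix G) x - tensor (laplacian G') x - tensor Z v,
       tensor (transpose Z) x) | a. a \<in> product_op A x})"

text \<open>\<open>(M + A)\<^sup>-\<^sup>1\<close> is taken as a set-valued inverse; for maximally monotone \<open>A i\<close> and an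
  algorithmic graph \<open>G\<close> its values are singletons, and \<open>the_elem\<close> reads it as a map.\<close>

definition reduced_op ::
    "('n::finite \<Rightarrow> 'a \<Rightarrow> 'a set) \<Rightarrow> 'n pair_pre_digraph \<Rightarrow> 'n pair_pre_digraph \<Rightarrow>
     real ^ 'm ^ 'n \<Rightarrow> 'a::real_inner ^ 'm \<Rightarrow> 'a ^ 'm" where
  "reduced_op A G G' Z v =
     adjoint (C_op Z) (the_elem (inverse_op (add_op (M_op G' Z) (A_op A G G' Z)) (C_op Z v)))"

end

theory Submission
  imports Defs
begin

text \<open>
  Write $\delta$ for the degree balance of $G$, $Z^\dagger$ for the Moore-Penrose inverse of $Z$,
  \<open>\<U>\<close> for the product of the $U_i$, $U$ for their intersection and \<open>\<Delta>\<close> for the diagonal.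
  
  Evaluating the resolvent at $C v$ means solving $Z v \in A_D(x) + P(G) x$ for $x$, because the
  Laplacian and the blocks $Z$ of $M$ and $A$ cancel; the second component is then
  $w = v - 2 Z^* x$. As arcs increase, $P(G)$ is lower triangular, so $x$ is found node by node,
  each $x_i$ being a projection onto $U_i$ of data already known (\<open>triangular_inclusion\<close>). Hence
  $T v = v - Z^* x$ (\<open>reduced_op_eq\<close>), and $v$ is a fixed point iff $Z^* x = 0$. The kernel of
  $Z^*$ is that of the connected Laplacian $Z Z^*$, namely \<open>\<Delta>\<close> (\<open>laplacian_kernel\<close>). On a
  constant vector $P(G)$ acts as multiplication by $\delta$, and so the fixed points are the $v$ with
  $Z v - \delta x \in$ \<open>\<U>\<^sup>\<bottom>\<close> for some $x \in U$ (\<open>Fix_reduced_op\<close>).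
  
  Counting dimensions, $Z$ is injective with range \<open>\<Delta>\<^sup>\<bottom>\<close>, so that $Z^\dagger$ inverts it there. Both
  $Z v$ and $\delta x$ lie in \<open>\<Delta>\<^sup>\<bottom>\<close>, the latter because the entries of $\delta$ sum to zero; with
  $\alpha = Z^\dagger \delta$ the condition becomes $v - \alpha x \in E$. Thus the fixed points form
  the sum of $\alpha U$ and $E$. The sum is orthogonal: for $u \in$ \<open>\<U>\<^sup>\<bottom>\<close>, moving $Z^\dagger$ to the other
  side turns $\langle \alpha x, Z^\dagger u\rangle$ into the inner product of $u$ with a vector all
  of whose entries are multiples of $x \in U$, an element of \<open>\<U>\<close>. The projection onto the sum is
  therefore the sum of the two projections (\<open>orth_proj_orthogonal_sum\<close>). The formula for the
  projection onto $\alpha U$ (\<open>tensor_vec_image_residual\<close>) requires \<open>\<alpha> \<noteq> 0\<close>, that is \<open>\<delta> \<noteq> 0\<close>: the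
  least node has outgoing arcs only (\<open>degree_balance_nonzero\<close>).
\<close>

section \<open>Orthogonal projections in a Hilbert space\<close>

lemma mem_orthogonal_comp: "x \<in> S\<^sup>\<bottom> \<longleftrightarrow> (\<forall>y\<in>S. x \<bullet> y = 0)"
  by (auto simp: orthogonal_comp_def orthogonal_def inner_commute)

lemma orth_proj_eqI:
  assumes "subspace S" "p \<in> S" "x - p \<in> S\<^sup>\<bottom>"
  shows "orth_proj S x = p"
  unfolding orth_proj_def
proof (rule the_equality)
  show "p \<in> S \<and> x - p \<in> S\<^sup>\<bottom>" using assms by simp
next
  fix q assume q: "q \<in> S \<and> x - q \<in> S\<^sup>\<bottom>"
  have "q - p \<in> S" using assms q by (simp add: subspace_diff)
  moreover have "(x - p) - (x - q) \<in> S\<^sup>\<bottom>"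
    using assms q subspace_diff[OF subspace_orthogonal_comp] by blast
  ultimately have "(q - p) \<bullet> (q - p) = 0"
    by (simp add: mem_orthogonal_comp)
  then show "q = p" by simp
qed

text \<open>
  The parallelogram law for $x - y$ and $x - z$. It shows that two points of a convex set that nearly
  realize the distance to $x$ are close to each other, since their midpoint stays at least at that
  distance.
\<close>

lemma parallelogram_midpoint:
  fixes x y z :: "'a::real_inner"
  shows "(dist y z)\<^sup>2 = 2 * (dist x y)\<^sup>2 + 2 * (dist x z)\<^sup>2 - 4 * (dist x ((1/2) *\<^sub>R (y + z)))\<^sup>2"
  unfolding dist_norm power2_norm_eq_inner
  by (simp add: inner_diff_left inner_diff_right inner_add_left inner_add_right
      inner_commute algebra_simps)

text \<open>
  The points of \<open>S\<close> in closed balls about \<open>x\<close> whose radii decrease to the distance form a nested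
  sequence of closed sets. Their diameters tend to zero by the parallelogram law, so completeness
  gives a common point. The residual at such a nearest point is orthogonal to \<open>S\<close>, since otherwise a
  step along \<open>S\<close> would come closer.
\<close>

lemma Hilbert_projection_exists:
  fixes S :: "'a::{real_inner,banach} set"
  assumes S: "subspace S" "closed S"
  obtains p where "p \<in> S" "x - p \<in> S\<^sup>\<bottom>"
proof -
  define d where "d = infdist x S"
  \<comment> \<open>With these radii the parallelogram law bounds squared diameters by \<open>4 / Suc n\<close>.\<close>
  define r where "r n = sqrt (d\<^sup>2 + 1 / Suc n)" for n :: nat
  define B where "B n = S \<inter> cball x (r n)" for n
  have ne: "S \<noteq> {}" using S(1) subspace_0 by blast
  have d0: "0 \<le> d" by (simp add: d_def infdist_nonneg)
  have d_le: "d \<le> dist x y" if "y \<in> S" for y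
    using that by (simp add: d_def infdist_le)
  have r2: "(r n)\<^sup>2 = d\<^sup>2 + 1 / Suc n" for n by (simp add: r_def)
  have r0: "0 \<le> r n" for n by (simp add: r_def)
  have dr: "d < r n" for n
    by (rule power2_less_imp_less) (simp_all add: r2 r0)
  obtain p where p: "\<And>n. p \<in> B n"
  proof (rule decreasing_closed_nest[of B])
    show "closed (B n)" for n using S(2) by (auto simp: B_def)
    show "B n \<noteq> {}" for n
    proof -
      have "\<exists>y\<in>S. dist x y < r n"
        using dr[of n] ne cINF_less_iff[of S "dist x" "r n"]
        by (auto simp: d_def infdist_notempty intro: bdd_belowI2[of _ 0])
      then show ?thesis by (force simp: B_def)
    qed
    show "B n \<subseteq> B m" if "m \<le> n" for m n
    proof -
      have "r n \<le> r m" using that by (simp add: r_def frac_le)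
      then show ?thesis by (auto simp: B_def)
    qed
    show "\<exists>n. \<forall>y\<in>B n. \<forall>z\<in>B n. dist y z < \<epsilon>" if "\<epsilon> > 0" for \<epsilon> :: real
    proof -
      obtain n where n: "1 / Suc n < \<epsilon>\<^sup>2 / 4"
        using reals_Archimedean[of "\<epsilon>\<^sup>2 / 4"] \<open>\<epsilon> > 0\<close> by (auto simp: inverse_eq_divide)
      have "dist y z < \<epsilon>" if "y \<in> B n" "z \<in> B n" for y z
      proof -
        have "(1/2) *\<^sub>R (y + z) \<in> S"
          using that S(1) by (simp add: B_def subspace_add subspace_scale)
        then have "d\<^sup>2 \<le> (dist x ((1/2) *\<^sub>R (y + z)))\<^sup>2"
          using d_le d0 by (simp add: power_mono)
        moreover have "(dist x y)\<^sup>2 \<le> (r n)\<^sup>2" "(dist x z)\<^sup>2 \<le> (r n)\<^sup>2"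
          using that by (auto simp: B_def intro!: power_mono)
        ultimately have "(dist y z)\<^sup>2 < \<epsilon>\<^sup>2"
          using n parallelogram_midpoint[of y z x] r2[of n] by linarith
        then show ?thesis using \<open>\<epsilon> > 0\<close> by (simp add: power2_less_imp_less)
      qed
      then show ?thesis by blast
    qed
  qed blast
  have pS: "p \<in> S" using p[of 0] by (simp add: B_def)
  have "(dist x p)\<^sup>2 \<le> d\<^sup>2"
  proof (rule field_le_epsilon)
    fix e :: real assume "e > 0"
    then obtain n where "1 / Suc n < e"
      using reals_Archimedean[of e] by (auto simp: inverse_eq_divide)
    moreover have "(dist x p)\<^sup>2 \<le> (r n)\<^sup>2"
      using p[of n] by (auto simp: B_def intro!: power_mono)
    ultimately show "(dist x p)\<^sup>2 \<le> d\<^sup>2 + e" using r2[of n] by linarith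
  qed
  then have nearest: "(dist x p)\<^sup>2 \<le> (dist x y)\<^sup>2" if "y \<in> S" for y
    using d_le[OF that] d0 power_mono[of d "dist x y" 2] by linarith
  have "(x - p) \<bullet> y = 0" if "y \<in> S" for y
  proof (cases "y = 0")
    case False
    \<comment> \<open>The step length that minimizes the distance from \<open>x\<close> along the line through \<open>p\<close>.\<close>
    define t where "t = ((x - p) \<bullet> y) / (y \<bullet> y)"
    have "p + t *\<^sub>R y \<in> S" using pS that S(1) by (simp add: subspace_add subspace_scale)
    from nearest[OF this]
    have "0 \<le> t\<^sup>2 * (y \<bullet> y) - 2 * t * ((x - p) \<bullet> y)"
      unfolding dist_norm power2_norm_eq_inner
      by (simp add: inner_diff_left inner_diff_right inner_add_left inner_add_right
          inner_commute algebra_simps power2_eq_square)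
    also have "\<dots> = - (((x - p) \<bullet> y)\<^sup>2 / (y \<bullet> y))"
      using False by (simp add: t_def power2_eq_square field_simps)
    finally have "((x - p) \<bullet> y)\<^sup>2 / (y \<bullet> y) \<le> 0" by simp
    moreover have "y \<bullet> y > 0" using False by simp
    ultimately have "((x - p) \<bullet> y)\<^sup>2 \<le> 0" by (simp add: divide_le_0_iff)
    then show ?thesis by simp
  qed simp
  then show ?thesis using that pS by (auto simp: mem_orthogonal_comp)
qed

lemma orth_proj_works:
  fixes S :: "'a::{real_inner,banach} set"
  assumes "subspace S" "closed S"
  shows "orth_proj S x \<in> S" "x - orth_proj S x \<in> S\<^sup>\<bottom>"
  using Hilbert_projection_exists[OF assms, of x] orth_proj_eqI[OF assms(1)] by metis+

lemma orth_proj_unique_iff: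
  fixes S :: "'a::{real_inner,banach} set"
  assumes "subspace S" "closed S"
  shows "p \<in> S \<and> x - p \<in> S\<^sup>\<bottom> \<longleftrightarrow> p = orth_proj S x"
  using orth_proj_works[OF assms] orth_proj_eqI[OF assms(1)] by metis

text \<open>
  Against vectors of \<open>S\<close>, subtracting \<open>q\<close> as well does not change the residual of \<open>v\<close>, by
  orthogonality; likewise for \<open>p\<close> against \<open>T\<close>.
\<close>

lemma orth_proj_orthogonal_sum:
  fixes S T :: "'a::real_inner set"
  assumes "subspace S" "subspace T" and orth: "\<And>s t. s \<in> S \<Longrightarrow> t \<in> T \<Longrightarrow> s \<bullet> t = 0"
    and p: "p \<in> S" "v - p \<in> S\<^sup>\<bottom>" and q: "q \<in> T" "v - q \<in> T\<^sup>\<bottom>"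
  shows "orth_proj {s + t | s t. s \<in> S \<and> t \<in> T} v = p + q"
proof (rule orth_proj_eqI)
  show "subspace {s + t | s t. s \<in> S \<and> t \<in> T}" using assms by (intro subspace_sums)
  show "p + q \<in> {s + t | s t. s \<in> S \<and> t \<in> T}" using p q by blast
  have "(v - (p + q)) \<bullet> (s + t) = 0" if "s \<in> S" "t \<in> T" for s t
  proof -
    have "(v - p) \<bullet> s = 0" "(v - q) \<bullet> t = 0" "q \<bullet> s = 0" "p \<bullet> t = 0"
      using that p q orth[of s q] orth[of p t]
      by (auto simp: mem_orthogonal_comp inner_commute[of q s])
    then show ?thesis by (simp add: inner_diff_left inner_add_left inner_add_right)
  qed
  then show "v - (p + q) \<in> {s + t | s t. s \<in> S \<and> t \<in> T}\<^sup>\<bottom>"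
    by (auto simp: mem_orthogonal_comp)
qed

section \<open>Real matrices acting on powers of a Hilbert space\<close>

lemma tensor_nth [simp]: "tensor K x $ i = (\<Sum>j\<in>UNIV. K $ i $ j *\<^sub>R x $ j)"
  by (simp add: tensor_def)

lemma tensor_vec_nth [simp]: "tensor_vec \<beta> x $ i = \<beta> $ i *\<^sub>R x"
  by (simp add: tensor_vec_def)

lemma tensor_add: "tensor K (x + y) = tensor K x + tensor K y"
  by (simp add: vec_eq_iff scaleR_add_right sum.distrib)

lemma tensor_diff: "tensor K (x - y) = tensor K x - tensor K y"
  by (simp add: vec_eq_iff scaleR_diff_right sum_subtractf)

lemma linear_tensor: "linear (tensor K)"
  by (intro linearI tensor_add) (simp add: vec_eq_iff scaleR_sum_right ac_simps)

lemma linear_tensor_vec: "linear (tensor_vec \<beta>)"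
  by (intro linearI) (simp_all add: vec_eq_iff scaleR_add_right ac_simps)

lemma continuous_tensor:
  fixes K :: "real ^ 'p ^ 'm"
  shows "continuous_on UNIV (tensor K :: 'a::real_normed_vector ^ 'p \<Rightarrow> _)"
  unfolding tensor_def by (intro continuous_intros)

lemma tensor_mul: "tensor (K ** L) x = tensor K (tensor L x)"
proof -
  have "(\<Sum>j\<in>UNIV. (\<Sum>k\<in>UNIV. K $ i $ k * L $ k $ j) *\<^sub>R x $ j)
      = (\<Sum>k\<in>UNIV. K $ i $ k *\<^sub>R (\<Sum>j\<in>UNIV. L $ k $ j *\<^sub>R x $ j))" for i
    by (simp add: scaleR_sum_left scaleR_sum_right) (rule sum.swap)
  then show ?thesis by (simp add: vec_eq_iff matrix_matrix_mult_def)
qed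

lemma tensor_mat_1 [simp]: "tensor (mat 1) x = x"
proof -
  have "(\<Sum>j\<in>UNIV. (if i = j then 1 else 0) *\<^sub>R x $ j) = x $ i" for i
    by (simp add: if_distrib[of "\<lambda>c. c *\<^sub>R _"] cong: if_cong)
  then show ?thesis by (simp add: vec_eq_iff mat_def)
qed

lemma tensor_real_eq_matrix_vector_mult: "tensor K x = K *v x" for x :: "real ^ 'p"
  by (simp add: vec_eq_iff matrix_vector_mult_def)

lemma tensor_tensor_vec: "tensor K (tensor_vec \<beta> x) = tensor_vec (K *v \<beta>) x"
  by (simp add: vec_eq_iff matrix_vector_mult_def scaleR_sum_left)

lemma inner_tensor_left:
  fixes x :: "'a::real_inner ^ 'p"
  shows "tensor K x \<bullet> y = x \<bullet> tensor (transpose K) y"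
proof -
  have "tensor K x \<bullet> y = (\<Sum>i\<in>UNIV. \<Sum>j\<in>UNIV. K $ i $ j * (x $ j \<bullet> y $ i))"
    by (simp add: inner_vec_def inner_sum_left)
  also have "\<dots> = (\<Sum>j\<in>UNIV. \<Sum>i\<in>UNIV. K $ i $ j * (x $ j \<bullet> y $ i))"
    by (rule sum.swap)
  also have "\<dots> = x \<bullet> tensor (transpose K) y"
    by (simp add: inner_vec_def inner_sum_right transpose_def)
  finally show ?thesis .
qed

text \<open>
  The choice in the definition of the adjoint is harmless here: an explicit candidate satisfies the
  defining identity, and an adjoint is unique whenever it exists.
\<close>

lemma adjoint_C_op: "adjoint (C_op Z) = (\<lambda>(x, w). tensor (transpose Z) x + w)"
  by (rule adjoint_unique) (simp add: C_op_def inner_tensor_left inner_add_right)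

text \<open>
  Up to the factor \<open>norm \<alpha>\<close>, \<open>x \<mapsto> \<alpha> \<otimes> x\<close> is an isometry, and \<open>tensor_vec_pinv \<alpha>\<close> is its adjoint divided by
  \<open>(norm \<alpha>)\<^sup>2\<close>. So the residual is orthogonal to the image of \<open>S\<close> because the residual of the
  pulled-back vector is orthogonal to \<open>S\<close>.
\<close>

lemma tensor_vec_image_residual:
  fixes S :: "'a::{real_inner,banach} set"
  assumes S: "subspace S" "closed S" and "\<alpha> \<noteq> 0"
  shows "v - tensor_vec \<alpha> (orth_proj S (tensor_vec_pinv \<alpha> v)) \<in> (tensor_vec \<alpha> ` S)\<^sup>\<bottom>"
proof -
  define w where "w = tensor_vec_pinv \<alpha> v"
  have norm2: "(\<Sum>j\<in>UNIV. \<alpha> $ j * \<alpha> $ j) = (norm \<alpha>)\<^sup>2"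
    by (simp add: power2_norm_eq_inner inner_vec_def)
  have pairing: "v \<bullet> tensor_vec \<alpha> y = (norm \<alpha>)\<^sup>2 * (w \<bullet> y)" for y
    using \<open>\<alpha> \<noteq> 0\<close> by (simp add: w_def tensor_vec_pinv_def inner_vec_def inner_sum_left)
  have norm2_pairing: "tensor_vec \<alpha> x \<bullet> tensor_vec \<alpha> y = (norm \<alpha>)\<^sup>2 * (x \<bullet> y)" for x y :: 'a
    by (simp add: inner_vec_def flip: norm2 sum_distrib_right mult.assoc)
  have "(w - orth_proj S w) \<bullet> y = 0" if "y \<in> S" for y
    using orth_proj_works(2)[OF S] that by (simp add: mem_orthogonal_comp)
  then show ?thesis
    by (simp add: mem_orthogonal_comp inner_diff_left pairing norm2_pairing flip: w_def)
qed

section \<open>Products of subspaces and the diagonal\<close>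

lemma mem_orthogonal_product_space:
  fixes U :: "'n::finite \<Rightarrow> 'a::real_inner set"
  assumes "\<And>i. subspace (U i)"
  shows "y \<in> (product_space U)\<^sup>\<bottom> \<longleftrightarrow> (\<forall>i. y $ i \<in> (U i)\<^sup>\<bottom>)"
proof
  assume y: "y \<in> (product_space U)\<^sup>\<bottom>"
  show "\<forall>i. y $ i \<in> (U i)\<^sup>\<bottom>"
    unfolding mem_orthogonal_comp
  proof (intro allI ballI)
    fix i u assume u: "u \<in> U i"
    have "(\<chi> j. if j = i then u else 0) \<in> product_space U"
      using u assms by (simp add: product_space_def subspace_0)
    then have "y \<bullet> (\<chi> j. if j = i then u else 0) = 0"
      using y by (simp add: mem_orthogonal_comp)
    then show "y $ i \<bullet> u = 0"
      by (simp add: inner_vec_def if_distrib[of "inner _"] cong: if_cong)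
  qed
qed (simp add: mem_orthogonal_comp product_space_def inner_vec_def)

lemma closed_orthogonal_comp: "closed (S\<^sup>\<bottom>)"
proof -
  have "S\<^sup>\<bottom> = (\<Inter>y\<in>S. {x. x \<bullet> y = 0})" by (auto simp: mem_orthogonal_comp)
  moreover have "closed {x. x \<bullet> y = 0}" for y :: 'a
    by (intro closed_Collect_eq continuous_intros)
  ultimately show ?thesis by auto
qed

lemma mem_orthogonal_diagonal:
  fixes y :: "'a::real_inner ^ 'n"
  shows "y \<in> diagonal_space\<^sup>\<bottom> \<longleftrightarrow> (\<Sum>i\<in>UNIV. y $ i) = 0"
proof -
  have "y \<bullet> (\<chi> i. x) = (\<Sum>i\<in>UNIV. y $ i) \<bullet> x" for x
    by (simp add: inner_vec_def inner_sum_left)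
  then show ?thesis
    by (auto simp: mem_orthogonal_comp diagonal_space_def)
qed

section \<open>Degrees and Laplacians\<close>

lemma in_degree_sum:
  fixes G :: "'n::finite pair_pre_digraph"
  shows "real (in_degree (with_proj G) i) = (\<Sum>j\<in>UNIV. if (j, i) \<in> parcs G then 1 else 0)"
proof -
  have "in_arcs (with_proj G) i = (\<lambda>j. (j, i)) ` {j. (j, i) \<in> parcs G}"
    by (auto simp: in_arcs_def)
  then show ?thesis
    by (simp add: in_degree_def card_image inj_on_def sum.If_cases)
qed

lemma out_degree_sum:
  fixes G :: "'n::finite pair_pre_digraph"
  shows "real (out_degree (with_proj G) i) = (\<Sum>j\<in>UNIV. if (i, j) \<in> parcs G then 1 else 0)"
proof -
  have "out_arcs (with_proj G) i = (\<lambda>j. (i, j)) ` {j. (i, j) \<in> parcs G}"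
    by (auto simp: out_arcs_def)
  then show ?thesis
    by (simp add: out_degree_def card_image inj_on_def sum.If_cases)
qed

lemma connected_rtrancl:
  assumes "graph_connected G" "pverts G = UNIV"
  shows "(i, j) \<in> (parcs G \<union> (parcs G)\<inverse>)\<^sup>*"
proof -
  have "parcs (mk_symmetric (with_proj G)) = parcs G \<union> (parcs G)\<inverse>"
    by (force simp: parcs_mk_symmetric)
  moreover have "i \<rightarrow>\<^sup>*\<^bsub>with_proj (mk_symmetric (with_proj G))\<^esub> j"
    using assms by (simp add: Digraph_Component.connected_def strongly_connected_def)
  ultimately show ?thesis using reachable_rtranclI by fastforce
qed

lemma connected_degree_pos:
  fixes G :: "'n::finite pair_pre_digraph"
  assumes "graph_connected G" "pverts G = UNIV" "CARD('n) \<ge> 2"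
  shows "graph_degree G i > 0"
proof -
  have "\<not> (UNIV :: 'n set) \<subseteq> {i}"
    using assms(3) card_mono[of "{i}" "UNIV :: 'n set"] by auto
  then obtain j where "j \<noteq> i" by blast
  then obtain k where "(i, k) \<in> parcs G \<union> (parcs G)\<inverse>"
    using connected_rtrancl[OF assms(1,2), of i j] by (metis converse_rtranclE)
  then have "in_arcs (with_proj G) i \<noteq> {} \<or> out_arcs (with_proj G) i \<noteq> {}"
    by (auto simp: in_arcs_def out_arcs_def)
  moreover have "finite (in_arcs (with_proj G) i)" "finite (out_arcs (with_proj G) i)"
    by (simp_all add: in_arcs_def out_arcs_def)
  ultimately show ?thesis
    by (auto simp: graph_degree_def in_degree_def out_degree_def card_gt_0_iff)
qed

text \<open>
  The ordering of the nodes excludes loops and pairs of opposite arcs. The degree, which counts arcs,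
  therefore equals the number of adjacent nodes, as this formula requires.
\<close>

lemma laplacian_nth:
  fixes G :: "'n::{finite,linorder} pair_pre_digraph" and y :: "'a::real_vector ^ ('n::{finite,linorder})"
  assumes ord: "\<forall>(i, j) \<in> parcs G. i < j"
  shows "tensor (laplacian G) y $ i =
    (\<Sum>j\<in>UNIV. (if (i, j) \<in> parcs G \<or> (j, i) \<in> parcs G then 1 else 0) *\<^sub>R (y $ i - y $ j))"
proof -
  define a where "a i j = (if (i, j) \<in> parcs G \<or> (j, i) \<in> parcs G then 1 else 0 :: real)" for i j
  have asym: "(j, i) \<notin> parcs G" if "(i, j) \<in> parcs G" for i j
    using bspec[OF ord, of "(i, j)"] bspec[OF ord, of "(j, i)"] that by auto
  have deg: "real (graph_degree G i) = (\<Sum>j\<in>UNIV. a i j)"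
    unfolding graph_degree_def of_nat_add in_degree_sum out_degree_sum sum.distrib[symmetric]
    by (rule sum.cong) (auto simp: a_def dest: asym)
  have entry: "laplacian G $ i $ j = (if i = j then real (graph_degree G i) else 0) - a i j" for j
    by (use ord in \<open>auto simp: laplacian_def a_def\<close>)
  have "tensor (laplacian G) y $ i
      = (\<Sum>j\<in>UNIV. if i = j then real (graph_degree G i) *\<^sub>R y $ j else 0) - (\<Sum>j\<in>UNIV. a i j *\<^sub>R y $ j)"
    by (simp add: entry scaleR_diff_left sum_subtractf if_distrib[of "\<lambda>c. c *\<^sub>R _"] cong: if_cong)
  also have "\<dots> = (\<Sum>j\<in>UNIV. a i j *\<^sub>R (y $ i - y $ j))"
    by (simp add: deg scaleR_diff_right sum_subtractf scaleR_sum_left)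
  finally show ?thesis by (simp add: a_def)
qed

lemma laplacian_quadratic_form:
  fixes G :: "'n::{finite,linorder} pair_pre_digraph" and y :: "'a::real_inner ^ ('n::{finite,linorder})"
  assumes ord: "\<forall>(i, j) \<in> parcs G. i < j"
  shows "2 * (y \<bullet> tensor (laplacian G) y) =
    (\<Sum>i\<in>UNIV. \<Sum>j\<in>UNIV. if (i, j) \<in> parcs G \<or> (j, i) \<in> parcs G then (norm (y $ i - y $ j))\<^sup>2 else 0)"
proof -
  define a where "a i j = (if (i, j) \<in> parcs G \<or> (j, i) \<in> parcs G then 1 else 0 :: real)" for i j
  have sym: "a i j = a j i" for i j by (auto simp: a_def)
  have form: "y \<bullet> tensor (laplacian G) y = (\<Sum>i\<in>UNIV. \<Sum>j\<in>UNIV. a i j * (y $ i \<bullet> (y $ i - y $ j)))"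
    unfolding inner_vec_def laplacian_nth[OF ord] by (simp add: inner_sum_right a_def del: tensor_nth)
  also have "\<dots> = (\<Sum>j\<in>UNIV. \<Sum>i\<in>UNIV. a i j * (y $ i \<bullet> (y $ i - y $ j)))"
    by (rule sum.swap)
  finally have form': "y \<bullet> tensor (laplacian G) y =
      (\<Sum>i\<in>UNIV. \<Sum>j\<in>UNIV. a i j * (y $ j \<bullet> (y $ j - y $ i)))"
    by (simp add: sym)
  have "2 * (y \<bullet> tensor (laplacian G) y) =
      (\<Sum>i\<in>UNIV. \<Sum>j\<in>UNIV. a i j * (y $ i \<bullet> (y $ i - y $ j)) + a i j * (y $ j \<bullet> (y $ j - y $ i)))"
    unfolding sum.distrib using form form' by simp
  also have "\<dots> = (\<Sum>i\<in>UNIV. \<Sum>j\<in>UNIV. a i j * (norm (y $ i - y $ j))\<^sup>2)"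
    by (intro sum.cong refl)
      (simp add: power2_norm_eq_inner inner_diff_left inner_diff_right inner_commute algebra_simps)
  finally show ?thesis by (simp add: a_def if_distrib[of "\<lambda>c. c * _"] cong: if_cong)
qed

text \<open>
  The quadratic form is a sum of squared differences along arcs. If it vanishes, the vector is
  constant along arcs, hence everywhere by connectedness.
\<close>

lemma laplacian_kernel:
  fixes G :: "'n::{finite,linorder} pair_pre_digraph" and y :: "'a::real_inner ^ ('n::{finite,linorder})"
  assumes ord: "\<forall>(i, j) \<in> parcs G. i < j"
    and conn: "graph_connected G" "pverts G = UNIV"
  shows "tensor (laplacian G) y = 0 \<longleftrightarrow> y \<in> diagonal_space"
proof
  assume "tensor (laplacian G) y = 0"
  then have "(\<Sum>i\<in>UNIV. \<Sum>j\<in>UNIV.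
      if (i, j) \<in> parcs G \<or> (j, i) \<in> parcs G then (norm (y $ i - y $ j))\<^sup>2 else 0) = 0"
    using laplacian_quadratic_form[OF ord, of y] by simp
  then have adj: "y $ i = y $ j" if "(i, j) \<in> parcs G \<union> (parcs G)\<inverse>" for i j
    using that by (auto simp: sum_nonneg_eq_0_iff sum_nonneg split: if_splits)
  have "y $ i = y $ j" for i j
    using connected_rtrancl[OF conn, of i j]
  proof (induction rule: rtrancl_induct)
    case (step k l)
    then show ?case using adj[of k l] by simp
  qed simp
  then have "y = (\<chi> i. y $ j)" for j by (simp add: vec_eq_iff)
  then show "y \<in> diagonal_space" unfolding diagonal_space_def by blast
next
  assume "y \<in> diagonal_space"
  then show "tensor (laplacian G) y = 0"
    by (auto simp: vec_eq_iff laplacian_nth[OF ord] diagonal_space_def simp del: tensor_nth)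
qed

lemma sum_degree_balance:
  fixes G :: "'n::finite pair_pre_digraph"
  shows "(\<Sum>i\<in>UNIV. degree_balance G $ i) = 0"
proof -
  have "(\<Sum>i\<in>UNIV. \<Sum>j\<in>UNIV. if (i, j) \<in> parcs G then 1 else 0 :: real)
      = (\<Sum>i\<in>UNIV. \<Sum>j\<in>UNIV. if (j, i) \<in> parcs G then 1 else 0)"
    by (rule sum.swap)
  then show ?thesis
    by (simp add: degree_balance_def in_degree_sum out_degree_sum sum_subtractf)
qed

text \<open>
  No arc enters the least node, while connectedness gives it positive degree; the balance there is
  its out-degree.
\<close>

lemma degree_balance_nonzero:
  fixes G :: "'n::{finite,linorder} pair_pre_digraph"
  assumes "algorithmic_graph G"
  shows "degree_balance G \<noteq> 0"
proof -
  let ?m = "Min UNIV"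
  have "in_arcs (with_proj G) ?m = {}"
    using assms by (fastforce simp: in_arcs_def algorithmic_graph_def)
  then have "in_degree (with_proj G) ?m = 0" by (simp add: in_degree_def)
  moreover have "graph_degree G ?m > 0"
    using assms by (intro connected_degree_pos) (auto simp: algorithmic_graph_def)
  ultimately have "degree_balance G $ ?m > 0"
    by (simp add: degree_balance_def graph_degree_def)
  then show ?thesis by (metis less_irrefl zero_index)
qed

section \<open>Factorizations of a connected Laplacian\<close>

text \<open>
  Penrose's uniqueness argument: two solutions induce the same symmetric products with \<open>K\<close>, because
  \<open>K Y = (K X)(K Y)\<close>, when transposed, becomes \<open>(K Y)(K X) = K X\<close>, and similarly on the other side.
\<close>

lemma moore_penrose_eqI:
  assumes "K ** X ** K = K" "X ** K ** X = X"
    "transpose (K ** X) = K ** X" "transpose (X ** K) = X ** K"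
  shows "moore_penrose K = X"
  unfolding moore_penrose_def
proof (rule the_equality)
  fix Y assume Y: "K ** Y ** K = K \<and> Y ** K ** Y = Y \<and>
    transpose (K ** Y) = K ** Y \<and> transpose (Y ** K) = Y ** K"
  have "K ** Y = transpose (K ** X ** (K ** Y))"
    using assms(1) Y by (metis matrix_mul_assoc)
  also have "\<dots> = K ** Y ** (K ** X)"
    using assms Y by (metis matrix_transpose_mul)
  also have "\<dots> = K ** X" using Y by (metis matrix_mul_assoc)
  finally have KY: "K ** Y = K ** X" .
  have "Y ** K = transpose (Y ** K ** (X ** K))"
    using assms(1) Y by (metis matrix_mul_assoc)
  also have "\<dots> = X ** K ** (Y ** K)"
    using assms Y by (metis matrix_transpose_mul)
  also have "\<dots> = X ** K" using Y by (metis matrix_mul_assoc)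
  finally have YK: "Y ** K = X ** K" .
  show "Y = X" using Y assms(2) KY YK by (metis matrix_mul_assoc)
qed (use assms in simp)

text \<open>
  For injective \<open>Z\<close> the Gram matrix is invertible and the Moore-Penrose inverse is
  $(Z^* Z)^{-1} Z^*$.
\<close>

lemma moore_penrose_injective:
  fixes Z :: "real ^ 'm ^ 'n"
  assumes inj: "\<And>v. Z *v v = 0 \<Longrightarrow> v = 0"
  shows "moore_penrose Z ** Z = mat 1"
    and "transpose (Z ** moore_penrose Z) = Z ** moore_penrose Z"
proof -
  have "v = 0" if "(transpose Z ** Z) *v v = 0" for v
  proof -
    have "(Z *v v) \<bullet> (Z *v v) = v \<bullet> ((transpose Z ** Z) *v v)"
      by (simp add: inner_tensor_left tensor_mul flip: tensor_real_eq_matrix_vector_mult)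
    then show ?thesis using that inj by simp
  qed
  then obtain W where W: "W ** (transpose Z ** Z) = mat 1"
    using matrix_left_invertible_ker[of "transpose Z ** Z"] by blast
  then have W': "(transpose Z ** Z) ** W = mat 1" by (simp add: matrix_left_right_inverse)
  have tW: "transpose W = W"
  proof -
    have "transpose W ** (transpose Z ** Z) = mat 1"
      using arg_cong[OF W', of transpose] by (simp add: matrix_transpose_mul)
    then show ?thesis using W' by (metis matrix_mul_assoc matrix_mul_lid matrix_mul_rid)
  qed
  define X where "X = W ** transpose Z"
  have XZ: "X ** Z = mat 1" using W by (simp add: X_def matrix_mul_assoc)
  have tZX: "transpose (Z ** X) = Z ** X"
    by (simp add: X_def matrix_transpose_mul tW matrix_mul_assoc)
  have "moore_penrose Z = X"
    by (rule moore_penrose_eqI) (simp_all add: XZ tZX flip: matrix_mul_assoc)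
  then show "moore_penrose Z ** Z = mat 1"
    and "transpose (Z ** moore_penrose Z) = Z ** moore_penrose Z"
    using XZ tZX by auto
qed

text \<open>
  The dimension count \<open>card\<close> makes \<open>Z\<close> as narrow as the rank of the Laplacian permits, which is what
  forces \<open>Z\<close> to be injective.
\<close>

locale laplacian_factorization =
  fixes G :: "'n::{finite,linorder} pair_pre_digraph" and Z :: "real ^ 'm ^ ('n::{finite,linorder})"
  assumes ord: "\<forall>(i, j) \<in> parcs G. i < j"
    and conn: "graph_connected G" and verts: "pverts G = UNIV"
    and card: "CARD('m) + 1 = CARD('n)"
    and lap: "laplacian G = Z ** transpose Z"
begin

lemma kernel_transpose:
  fixes y :: "'a::real_inner ^ ('n::{finite,linorder})"
  shows "tensor (transpose Z) y = 0 \<longleftrightarrow> y \<in> diagonal_space"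
proof -
  have "tensor (transpose Z) y = 0 \<longleftrightarrow> tensor (laplacian G) y = 0"
  proof
    assume "tensor (laplacian G) y = 0"
    then have "tensor (transpose Z) y \<bullet> tensor (transpose Z) y = 0"
      by (simp add: inner_tensor_left lap tensor_mul)
    then show "tensor (transpose Z) y = 0" by simp
  qed (simp add: lap tensor_mul linear_0[OF linear_tensor])
  then show ?thesis using laplacian_kernel[OF ord conn verts] by blast
qed

lemma range_orthogonal_diagonal:
  fixes v :: "'a::real_inner ^ 'm"
  shows "tensor Z v \<in> diagonal_space\<^sup>\<bottom>"
  by (auto simp: mem_orthogonal_comp inner_tensor_left kernel_transpose[THEN iffD2])

text \<open>
  Adding to $Z^*$ the functional that sums the entries gives an injective map: a constant vector
  whose entries sum to zero vanishes. Domain and codomain have equal dimension, so the map is also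
  surjective; then $Z^*$ is surjective, and its transpose \<open>Z\<close> is injective.
\<close>

lemma injective:
  assumes "Z *v v = 0"
  shows "v = 0"
proof -
  define f where "f y = (tensor (transpose Z) y, \<Sum>i\<in>UNIV. y $ i)" for y :: "real ^ ('n::{finite,linorder})"
  have lin: "linear f"
    by (intro linearI) (simp_all add: f_def tensor_add sum.distrib
        linear_scale[OF linear_tensor] scaleR_Pair sum_distrib_left)
  have "inj f"
  proof -
    have "y = 0" if "f y = 0" for y
    proof -
      have "y \<in> diagonal_space" "y \<in> diagonal_space\<^sup>\<bottom>"
        using that by (auto simp: f_def zero_prod_def kernel_transpose mem_orthogonal_diagonal)
      then show ?thesis by (metis mem_orthogonal_comp inner_eq_zero_iff)
    qed
    then show ?thesis using lin by (simp add: linear_injective_0)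
  qed
  then have "dim (range f) = DIM((real ^ 'm) \<times> real)"
    using dim_image_eq[OF lin, of UNIV] card by simp
  then have "span (range f) = UNIV" using dim_eq_full[of "range f"] by metis
  then have "surj f" using span_linear_image[OF lin, of UNIV] by simp
  then obtain y where "(v, 0) = f y" by blast
  then have "v \<bullet> v = tensor Z v \<bullet> y" by (simp add: f_def inner_tensor_left)
  then show ?thesis using assms by (simp add: tensor_real_eq_matrix_vector_mult)
qed

lemma pinv_tensor: "tensor (moore_penrose Z) (tensor Z v) = v"
  using moore_penrose_injective(1)[of Z] injective by (simp flip: tensor_mul)

text \<open>
  $Z Z^\dagger$ is the orthogonal projection onto the range of \<open>Z\<close>. The defect \<open>r\<close> of the identity is
  annihilated by $Z^*$, hence constant, and is also orthogonal to the constants.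
\<close>

lemma tensor_pinv:
  fixes u :: "'a::real_inner ^ ('n::{finite,linorder})"
  assumes "u \<in> diagonal_space\<^sup>\<bottom>"
  shows "tensor Z (tensor (moore_penrose Z) u) = u"
proof -
  let ?K = "moore_penrose Z"
  define r where "r = u - tensor Z (tensor ?K u)"
  have "transpose Z ** (Z ** ?K) = transpose Z ** transpose (Z ** ?K)"
    using moore_penrose_injective(2)[of Z] injective by simp
  also have "\<dots> = transpose (Z ** ?K ** Z)" by (simp add: matrix_transpose_mul)
  also have "\<dots> = transpose Z"
    using moore_penrose_injective(1)[of Z] injective by (simp flip: matrix_mul_assoc)
  finally have "tensor (transpose Z) (tensor Z (tensor ?K u)) = tensor (transpose Z) u"
    by (simp flip: tensor_mul)
  then have "r \<in> diagonal_space" by (simp add: r_def tensor_diff flip: kernel_transpose)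
  moreover have "r \<in> diagonal_space\<^sup>\<bottom>"
    unfolding r_def
    by (intro subspace_diff subspace_orthogonal_comp assms range_orthogonal_diagonal)
  ultimately have "r \<bullet> r = 0" by (simp add: mem_orthogonal_comp)
  then show ?thesis by (simp add: r_def)
qed

text \<open>
  Applied to \<open>W = (product_space U)\<^sup>\<bottom>\<close>, this presents \<open>E\<close> as a preimage under a continuous linear map,
  whence it is a closed subspace.
\<close>

lemma pinv_image:
  fixes W :: "('a::real_inner ^ ('n::{finite,linorder})) set"
  shows "tensor (moore_penrose Z) ` (W \<inter> diagonal_space\<^sup>\<bottom>) = {v. tensor Z v \<in> W}"
proof (intro equalityI subsetI)
  fix v assume "v \<in> {v. tensor Z v \<in> W}"
  then show "v \<in> tensor (moore_penrose Z) ` (W \<inter> diagonal_space\<^sup>\<bottom>)"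
    using range_orthogonal_diagonal pinv_tensor by (metis (full_types) IntI image_eqI mem_Collect_eq)
qed (auto simp: tensor_pinv)

end

section \<open>The reduced operator\<close>

text \<open>
  Forward substitution: an equation whose \<open>i\<close>-th entry depends on earlier entries only is solved by
  well-founded recursion, and its solution is unique by well-founded induction.
\<close>

lemma triangular_fixed_point:
  fixes F :: "('n::{finite,linorder} \<Rightarrow> 'b) \<Rightarrow> 'n \<Rightarrow> 'b"
  assumes F: "\<And>f g i. (\<And>j. j < i \<Longrightarrow> f j = g j) \<Longrightarrow> F f i = F g i"
  shows "\<exists>!f. \<forall>i. f i = F f i"
proof -
  define R where "R = {(i, j :: 'n). i < j}"
  have "R \<subseteq> Wellfounded.measure (\<lambda>i. card {..<i})"
    by (auto simp: R_def intro!: psubset_card_mono)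
  then have wf: "wf R" by (rule wf_subset[OF wf_measure])
  have "adm_wf R F" unfolding adm_wf_def R_def by (intro allI impI F) simp
  then have "wfrec R F = F (wfrec R F)" by (rule wfrec_fixpoint[OF wf])
  then have "\<forall>i. wfrec R F i = F (wfrec R F) i" by simp
  moreover have "f = g" if f: "\<forall>i. f i = F f i" and g: "\<forall>i. g i = F g i" for f g
  proof
    fix i show "f i = g i"
      using wf
    proof (induction i rule: wf_induct_rule)
      case (less i)
      then have "F f i = F g i" by (intro F) (simp add: R_def)
      then show ?case using f g by metis
    qed
  qed
  ultimately show ?thesis by blast
qed

lemma P_matrix_nth:
  fixes G :: "'n::{finite,linorder} pair_pre_digraph" and x :: "'a::real_vector ^ ('n::{finite,linorder})"
  assumes ord: "\<forall>(i, j) \<in> parcs G. i < j"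
  shows "tensor (P_matrix G) x $ i = real (graph_degree G i) *\<^sub>R x $ i -
    2 *\<^sub>R (\<Sum>j\<in>UNIV. if (j, i) \<in> parcs G then x $ j else 0)"
proof -
  have "P_matrix G $ i $ j *\<^sub>R x $ j = (if i = j then real (graph_degree G i) *\<^sub>R x $ j else 0)
      - 2 *\<^sub>R (if (j, i) \<in> parcs G then x $ j else 0)" for j
    by (use ord in \<open>auto simp: P_matrix_def\<close>)
  then show ?thesis by (simp add: sum_subtractf scaleR_sum_right)
qed

text \<open>
  The \<open>i\<close>-th row of $P(G)$ sums to the degree minus twice the in-degree, that is to the out-degree
  minus the in-degree.
\<close>

lemma P_matrix_constant:
  fixes G :: "'n::{finite,linorder} pair_pre_digraph" and x :: "'a::real_vector"
  assumes ord: "\<forall>(i, j) \<in> parcs G. i < j"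
  shows "tensor (P_matrix G) (\<chi> i. x) = tensor_vec (degree_balance G) x"
proof -
  have "(\<Sum>j\<in>UNIV. if (j, i) \<in> parcs G then x else 0) = real (in_degree (with_proj G) i) *\<^sub>R x" for i
    by (simp add: in_degree_sum scaleR_sum_left if_distrib[of "\<lambda>c. c *\<^sub>R _"] cong: if_cong)
  then show ?thesis
    unfolding vec_eq_iff P_matrix_nth[OF ord] vec_lambda_beta
    by (simp add: degree_balance_def graph_degree_def flip: scaleR_diff_left)
qed

text \<open>
  Row \<open>i\<close> of the inclusion involves the node values that precede \<open>i\<close> and reads
  \<open>c - d\<^sub>i x\<^sub>i \<in> (U i)\<^sup>\<bottom>\<close> with \<open>x\<^sub>i \<in> U i\<close>, where \<open>c\<close> depends on those values and \<open>d\<^sub>i > 0\<close> is the degree. Dividing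
  by \<open>d\<^sub>i\<close> identifies \<open>x\<^sub>i\<close> as the projection of \<open>c / d\<^sub>i\<close>.
\<close>

lemma triangular_inclusion:
  fixes U :: "'n::{finite,linorder} \<Rightarrow> 'a::{real_inner,banach} set"
  assumes U: "\<And>i. subspace (U i)" "\<And>i. closed (U i)" and G: "algorithmic_graph G"
  shows "\<exists>!x. y - tensor (P_matrix G) x \<in> product_op (\<lambda>i. normal_cone (U i)) x"
proof -
  define d where "d i = real (graph_degree G i)" for i
  have ord: "\<forall>(i, j) \<in> parcs G. i < j"
    using G by (simp add: algorithmic_graph_def)
  have d: "d i > 0" for i
    using connected_degree_pos[of G i] G by (simp add: d_def algorithmic_graph_def)
  define c where "c f i = y $ i + 2 *\<^sub>R (\<Sum>j\<in>UNIV. if (j, i) \<in> parcs G then f j else 0)"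
    for f :: "'n \<Rightarrow> 'a" and i
  have fixed: "\<exists>!f. \<forall>i. f i = orth_proj (U i) ((1 / d i) *\<^sub>R c f i)"
  proof (rule triangular_fixed_point)
    fix f g :: "'n \<Rightarrow> 'a" and i assume "\<And>j. j < i \<Longrightarrow> f j = g j"
    then have "(\<Sum>j\<in>UNIV. if (j, i) \<in> parcs G then f j else 0)
        = (\<Sum>j\<in>UNIV. if (j, i) \<in> parcs G then g j else 0)"
      using ord by (intro sum.cong) auto
    then show "orth_proj (U i) ((1 / d i) *\<^sub>R c f i) = orth_proj (U i) ((1 / d i) *\<^sub>R c g i)"
      by (simp add: c_def)
  qed
  have solution: "y - tensor (P_matrix G) x \<in> product_op (\<lambda>i. normal_cone (U i)) x \<longleftrightarrow>
      (\<forall>i. x $ i = orth_proj (U i) ((1 / d i) *\<^sub>R c (($) x) i))" for x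
  proof -
    have "(y - tensor (P_matrix G) x) $ i \<in> normal_cone (U i) (x $ i) \<longleftrightarrow>
        x $ i = orth_proj (U i) ((1 / d i) *\<^sub>R c (($) x) i)" for i
    proof -
      have "(y - tensor (P_matrix G) x) $ i = c (($) x) i - d i *\<^sub>R x $ i"
        by (simp add: P_matrix_nth[OF ord] c_def d_def del: tensor_nth)
      also have "\<dots> = d i *\<^sub>R ((1 / d i) *\<^sub>R c (($) x) i - x $ i)"
        using d[of i] by (simp add: scaleR_diff_right)
      also have "\<dots> \<in> (U i)\<^sup>\<bottom> \<longleftrightarrow> (1 / d i) *\<^sub>R c (($) x) i - x $ i \<in> (U i)\<^sup>\<bottom>"
        using d[of i] by (simp add: mem_orthogonal_comp)
      finally have "(y - tensor (P_matrix G) x) $ i \<in> (U i)\<^sup>\<bottom> \<longleftrightarrow>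
          (1 / d i) *\<^sub>R c (($) x) i - x $ i \<in> (U i)\<^sup>\<bottom>" .
      then show ?thesis
        using orth_proj_unique_iff[OF U, of "x $ i" i "(1 / d i) *\<^sub>R c (($) x) i"]
        unfolding normal_cone_def by auto
    qed
    then show ?thesis by (simp add: product_op_def)
  qed
  obtain f where f: "\<forall>i. f i = orth_proj (U i) ((1 / d i) *\<^sub>R c f i)"
    and unique: "\<And>g. \<forall>i. g i = orth_proj (U i) ((1 / d i) *\<^sub>R c g i) \<Longrightarrow> g = f"
    using fixed by (elim ex1E) blast
  show ?thesis
  proof (rule ex1I)
    have f_vec: "($) (\<chi> i. f i) = f" by auto
    show "y - tensor (P_matrix G) (\<chi> i. f i) \<in> product_op (\<lambda>i. normal_cone (U i)) (\<chi> i. f i)"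
      unfolding solution f_vec by (rule f)
  next
    fix x assume "y - tensor (P_matrix G) x \<in> product_op (\<lambda>i. normal_cone (U i)) x"
    then have "($) x = f" unfolding solution by (rule unique)
    then show "x = (\<chi> i. f i)" by auto
  qed
qed

text \<open>
  In the first component of $M + A$ the Laplacian and the two occurrences of $Z w$ cancel; the
  second component reads $v = 2 Z^* x + w$. Adding $Z^* x$ to $w$ gives the value of $C^*$.
\<close>

lemma reduced_op_eq:
  fixes v :: "'a::real_inner ^ 'm"
  assumes x: "\<And>x'. tensor Z v - tensor (P_matrix G) x' \<in> product_op A x' \<longleftrightarrow> x' = x"
  shows "reduced_op A G G' Z v = v - tensor (transpose Z) x"
proof -
  have "C_op Z v \<in> add_op (M_op G' Z) (A_op A G G' Z) (x', w) \<longleftrightarrow>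
      x' = x \<and> w = v - 2 *\<^sub>R tensor (transpose Z) x'" for x' w
  proof -
    have "C_op Z v \<in> add_op (M_op G' Z) (A_op A G G' Z) (x', w) \<longleftrightarrow>
        (\<exists>a\<in>product_op A x'. C_op Z v = M_op G' Z (x', w) +
          (a + tensor (P_matrix G) x' - tensor (laplacian G') x' - tensor Z w,
           tensor (transpose Z) x'))"
      by (auto simp: add_op_def A_op_def)
    also have "\<dots> \<longleftrightarrow> (\<exists>a\<in>product_op A x'. a = tensor Z v - tensor (P_matrix G) x' \<and>
        w = v - 2 *\<^sub>R tensor (transpose Z) x')"
      by (intro bex_cong refl)
        (auto simp: C_op_def M_op_def block_tensor_def scaleR_2 eq_diff_eq diff_eq_eq ac_simps)
    also have "\<dots> \<longleftrightarrow> tensor Z v - tensor (P_matrix G) x' \<in> product_op A x' \<and>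
        w = v - 2 *\<^sub>R tensor (transpose Z) x'"
      by blast
    finally show ?thesis using x by blast
  qed
  then have "inverse_op (add_op (M_op G' Z) (A_op A G G' Z)) (C_op Z v)
      = {(x, v - 2 *\<^sub>R tensor (transpose Z) x)}"
    unfolding inverse_op_def by auto
  then show ?thesis by (simp add: reduced_op_def adjoint_C_op scaleR_2)
qed

text \<open>
  A fixed point is a \<open>v\<close> whose solution \<open>x\<close> lies in the kernel of $Z^*$, so \<open>x\<close> is constant; the
  inclusion then splits into membership of the common entry in every \<open>U i\<close> and an orthogonality
  condition in which $P(G)$ has become the degree balance.
\<close>

lemma Fix_reduced_op:
  fixes U :: "'n::{finite,linorder} \<Rightarrow> 'a::{real_inner,banach} set"
  assumes U: "\<And>i. subspace (U i)" "\<And>i. closed (U i)" and G: "algorithmic_graph G"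
    and Z: "laplacian_factorization G' Z"
  shows "Fix (reduced_op (\<lambda>i. normal_cone (U i)) G G' Z) =
    {v. \<exists>x\<in>\<Inter>i. U i. tensor Z v - tensor_vec (degree_balance G) x \<in> (product_space U)\<^sup>\<bottom>}"
proof -
  interpret laplacian_factorization G' Z by fact
  let ?N = "\<lambda>i. normal_cone (U i)"
  have ordG: "\<forall>(i, j) \<in> parcs G. i < j"
    using G by (simp add: algorithmic_graph_def)
  have "reduced_op ?N G G' Z v = v \<longleftrightarrow>
      (\<exists>x. tensor Z v - tensor (P_matrix G) (\<chi> i. x) \<in> product_op ?N (\<chi> i. x))" for v
  proof -
    obtain x where x: "tensor Z v - tensor (P_matrix G) x' \<in> product_op ?N x' \<longleftrightarrow> x' = x" for x'
      using triangular_inclusion[of U, OF U G, of "tensor Z v"] by (elim ex1E) blast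
    have "reduced_op ?N G G' Z v = v \<longleftrightarrow> tensor (transpose Z) x = 0"
      using reduced_op_eq[of Z v G ?N x G', OF x] by (simp only: diff_eq_eq) simp
    then show ?thesis unfolding kernel_transpose x by (auto simp: diagonal_space_def)
  qed
  moreover have "tensor Z v - tensor (P_matrix G) (\<chi> i. x) \<in> product_op ?N (\<chi> i. x) \<longleftrightarrow>
      x \<in> (\<Inter>i. U i) \<and> tensor Z v - tensor_vec (degree_balance G) x \<in> (product_space U)\<^sup>\<bottom>" for v x
    unfolding P_matrix_constant[OF ordG] mem_orthogonal_product_space[of U, OF U(1)]
    by (auto simp: product_op_def normal_cone_def split: if_splits)
  ultimately show ?thesis
    by (simp add: Fix_def Bex_def)
qed

section \<open>The projection onto the fixed points\<close>

theorem theorem4p4: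
  fixes U :: "'n::{finite,linorder} \<Rightarrow> 'a::{real_inner,banach} set"
    and A :: "'n \<Rightarrow> 'a \<Rightarrow> 'a set"
    and G G' :: "'n pair_pre_digraph"
    and Z :: "real ^ 'm ^ ('n::{finite,linorder})"
    and T :: "'a ^ 'm \<Rightarrow> 'a ^ 'm"
    and \<alpha> :: "real ^ 'm"
    and E :: "('a ^ 'm) set"
  assumes "\<And>i. subspace (U i)" and "\<And>i. closed (U i)"
    and "\<And>i. A i = normal_cone (U i)"
    and "algorithmic_graph G"
    and "spanning (with_proj G') (with_proj G)" and "graph_connected G'"
    and "CARD('m) + 1 = CARD('n)"
    and "laplacian G' = Z ** transpose Z"
    and "T = reduced_op A G G' Z"
    and "\<alpha> = moore_penrose Z *v degree_balance G"
    and "E = tensor (moore_penrose Z) ` ((product_space U)\<^sup>\<bottom> \<inter> diagonal_space\<^sup>\<bottom>)"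
  shows "orth_proj (Fix T) =
    (\<lambda>v. tensor_vec \<alpha> (orth_proj (\<Inter>i. U i) (tensor_vec_pinv \<alpha> v)) + orth_proj E v)"
proof
  fix v
  let ?K = "moore_penrose Z" and ?\<delta> = "degree_balance G" and ?W = "(product_space U)\<^sup>\<bottom>"
  let ?U = "\<Inter>i. U i"
  have A: "A = (\<lambda>i. normal_cone (U i))" using assms(3) by blast
  have "pverts G' = UNIV" "parcs G' \<subseteq> parcs G"
    using assms(4,5) by (auto simp: algorithmic_graph_def spanning_def subgraph_def)
  then interpret laplacian_factorization G' Z
    using assms(4,6,7,8) by unfold_locales (auto simp: algorithmic_graph_def)
  have U: "subspace ?U" "closed ?U" using assms(1,2) by (auto intro: subspace_Inter)
  have E_eq: "E = {v. tensor Z v \<in> ?W}" unfolding assms(11) by (rule pinv_image)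
  have E: "subspace E" "closed E"
  proof -
    have "E = tensor Z -` ?W" using E_eq by auto
    then show "subspace E" "closed E"
      by (simp_all add: linear_subspace_vimage[OF linear_tensor] subspace_orthogonal_comp
          closed_orthogonal_comp continuous_closed_vimage
          continuous_tensor[unfolded continuous_on_eq_continuous_at[OF open_UNIV]])
  qed
  have \<delta>_diag: "tensor_vec ?\<delta> x \<in> diagonal_space\<^sup>\<bottom>" for x :: "'b::real_inner"
    by (simp add: mem_orthogonal_diagonal sum_degree_balance flip: scaleR_sum_left)
  have Z\<alpha>: "tensor Z (tensor_vec \<alpha> x) = tensor_vec ?\<delta> x" for x :: 'a
    unfolding assms(10) by (simp only: tensor_pinv[OF \<delta>_diag] flip: tensor_tensor_vec)
  have "\<alpha> \<noteq> 0"
  proof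
    assume "\<alpha> = 0"
    have "?\<delta> \<in> diagonal_space\<^sup>\<bottom>" by (simp add: mem_orthogonal_diagonal sum_degree_balance)
    then have "Z *v \<alpha> = ?\<delta>"
      unfolding assms(10) tensor_real_eq_matrix_vector_mult[symmetric] by (rule tensor_pinv)
    then show False using \<open>\<alpha> = 0\<close> degree_balance_nonzero[OF assms(4)] by simp
  qed
  have Fix: "Fix T = {s + t | s t. s \<in> tensor_vec \<alpha> ` ?U \<and> t \<in> E}"
  proof -
    have mem: "v \<in> Fix T \<longleftrightarrow> (\<exists>x\<in>?U. v - tensor_vec \<alpha> x \<in> E)" for v
      unfolding assms(9) A Fix_reduced_op[of U, OF assms(1,2,4) laplacian_factorization_axioms]
      by (simp add: E_eq tensor_diff Z\<alpha>)
    show ?thesis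
    proof (intro equalityI subsetI)
      fix v assume "v \<in> Fix T"
      then obtain x where "x \<in> ?U" "v - tensor_vec \<alpha> x \<in> E" using mem by blast
      moreover have "v = tensor_vec \<alpha> x + (v - tensor_vec \<alpha> x)" by simp
      ultimately show "v \<in> {s + t | s t. s \<in> tensor_vec \<alpha> ` ?U \<and> t \<in> E}" by blast
    next
      fix v assume "v \<in> {s + t | s t. s \<in> tensor_vec \<alpha> ` ?U \<and> t \<in> E}"
      then obtain x t where "x \<in> ?U" "t \<in> E" "v = tensor_vec \<alpha> x + t" by blast
      then show "v \<in> Fix T" unfolding mem by (intro bexI[of _ x]) simp_all
    qed
  qed
  \<comment> \<open>Moved to the other side, the pseudoinverse acts on the coefficients \<open>\<alpha>\<close> only.\<close>
  have orth: "s \<bullet> t = 0" if "s \<in> tensor_vec \<alpha> ` ?U" "t \<in> E" for s t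
  proof -
    obtain x where x: "x \<in> ?U" "s = tensor_vec \<alpha> x" using \<open>s \<in> _\<close> by blast
    obtain u where u: "u \<in> ?W" "t = tensor ?K u" using \<open>t \<in> E\<close> assms(11) by blast
    have "tensor_vec (transpose ?K *v \<alpha>) x \<in> product_space U"
      using x assms(1) by (simp add: product_space_def subspace_scale)
    then have "u \<bullet> tensor_vec (transpose ?K *v \<alpha>) x = 0"
      using u by (simp add: mem_orthogonal_comp)
    then show ?thesis
      by (simp add: x u inner_tensor_left tensor_tensor_vec inner_commute[of "tensor_vec \<alpha> x"])
  qed
  show "orth_proj (Fix T) v =
      tensor_vec \<alpha> (orth_proj ?U (tensor_vec_pinv \<alpha> v)) + orth_proj E v"
    unfolding Fix
    using U E orth \<open>\<alpha> \<noteq> 0\<close>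
    by (intro orth_proj_orthogonal_sum linear_subspace_image[OF linear_tensor_vec]
        tensor_vec_image_residual orth_proj_works imageI)
qed

end
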